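(* Let $n=2$ and let $\mathcal{D}$ be the set of all value density functions $f:[0,1]\to\mathbb{R}_{>0}$ that are piecewise-constant and strictly positive everywhere (hungry agents). There is no mechanism $\mathcal{M}:\mathcal{D}\times\mathcal{D}\to\{\text{allocations}\}$ that is simultaneously truthful and proportional on $\mathcal{D}\times\mathcal{D}$. This holds even though the mechanism is not required to be entire (i.e., it may leave part of the cake unallocated).
   Context: The cake is $[0,1]$. Each agent $i$ has a value density function $f_i:[0,1]\to\mathbb{R}_{\ge 0}$; $f_i$ is piecewise-constant if $[0,1]$ can be partitioned into finitely many intervals on each of which $f_i$ is constant. Agent $i$'s utility for a measurable $X\subseteq[0,1]$ is $v_i(X)=\int_X f_i(x)\,dx$. An allocation is a tuple $(A_1,\dots,A_n)$ of pairwise disjoint measurable subsets of $[0,1]$; it is entire if $\bigcup_i A_i=[0,1]$. A mechanism $\mathcal{M}$ maps a profile $F=(f_1,\dots,f_n)$ of (reported) densities to an allocation; $\mathcal{M}_i(F)$ denotes agent $i$'s piece. $\mathcal{M}$ is proportional if for every input profile, $v_i(\mathcal{M}_i(F))\ge \frac1n v_i([0,1])$ for all $i$, where $v_i$ is computed with the reported $f_i$. $\mathcal{M}$ is truthful if for every $i$, every profile $(f_1,\dots,f_n)$ in the domain and every $f_i'$ in the domain, $v_i(\mathcal{M}_i(f_1,\dots,f_n))\ge v_i(\mathcal{M}_i(f_1,\dots,f_{i-1},f_i',f_{i+1},\dots,f_n))$, where $v_i$ is computed with the true $f_i$. Mechanisms are deterministic. *)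

theory Defs
  imports "HOL-Analysis.Analysis"
begin

text \<open>A value density on the cake [0,1], represented as a real function that is 0 outside [0,1].
  It is piecewise constant if [0,1] can be partitioned into finitely many intervals
  on each of which it is constant.\<close>

definition piecewise_constant :: "(real \<Rightarrow> real) \<Rightarrow> bool" where
  "piecewise_constant f \<longleftrightarrow>
     (\<exists>\<I> :: real set set. finite \<I> \<and> (\<forall>I\<in>\<I>. is_interval I) \<and> disjoint \<I> \<and>
        \<Union>\<I> = {0..1} \<and> (\<forall>I\<in>\<I>. \<forall>x\<in>I. \<forall>y\<in>I. f x = f y))"

definition hungry_domain :: "(real \<Rightarrow> real) set" where
  "hungry_domain = {f. piecewise_constant f \<and> (\<forall>x\<in>{0..1}. f x > 0) \<and> (\<forall>x. x \<notin> {0..1} \<longrightarrow> f x = 0)}"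

definition util :: "(real \<Rightarrow> real) \<Rightarrow> real set \<Rightarrow> real" where
  "util f X = set_lebesgue_integral lebesgue X f"

definition allocation2 :: "real set \<times> real set \<Rightarrow> bool" where
  "allocation2 A \<longleftrightarrow> fst A \<in> sets lebesgue \<and> snd A \<in> sets lebesgue \<and>
     fst A \<subseteq> {0..1} \<and> snd A \<subseteq> {0..1} \<and> fst A \<inter> snd A = {}"

definition proportional2 :: "(real \<Rightarrow> real) set \<Rightarrow> ((real \<Rightarrow> real) \<Rightarrow> (real \<Rightarrow> real) \<Rightarrow> real set \<times> real set) \<Rightarrow> bool" where
  "proportional2 D M \<longleftrightarrow> (\<forall>f1\<in>D. \<forall>f2\<in>D.
      util f1 (fst (M f1 f2)) \<ge> util f1 {0..1} / 2 \<and> util f2 (snd (M f1 f2)) \<ge> util f2 {0..1} / 2)"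

definition truthful2 :: "(real \<Rightarrow> real) set \<Rightarrow> ((real \<Rightarrow> real) \<Rightarrow> (real \<Rightarrow> real) \<Rightarrow> real set \<times> real set) \<Rightarrow> bool" where
  "truthful2 D M \<longleftrightarrow> (\<forall>f1\<in>D. \<forall>f2\<in>D. \<forall>g\<in>D.
      util f1 (fst (M f1 f2)) \<ge> util f1 (fst (M g f2)) \<and>
      util f2 (snd (M f1 f2)) \<ge> util f2 (snd (M f1 g)))"

end

theory Submission
  imports Defs
begin

text \<open>Let \<open>A\<close> be agent 1's piece when both report the uniform density \<open>1\<close>; it has length \<open>1/2\<close>.
  Let \<open>g\<^sub>1 = 3\<close> on \<open>A\<close> and \<open>5\<close> off \<open>A\<close>. Against \<open>g\<^sub>1\<close>, agent 1 never gets length above \<open>1/2\<close>, which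
  forces the piece \<open>C\<close> obtained by reporting \<open>7\<close> on \<open>A\<close> and \<open>9\<close> off \<open>A\<close> to contain half of \<open>A\<close> and half of
  its complement. Let \<open>f\<close> take the values \<open>7, 3, 5, 1\<close> on \<open>A \<inter> C\<close>, \<open>A - C\<close>, \<open>C - A\<close> and the rest, so that
  \<open>max f g\<^sub>1\<close> is \<open>f\<close> on \<open>C\<close> and \<open>g\<^sub>1\<close> elsewhere. Since agent 1 with density \<open>f\<close> can obtain \<open>C\<close> against
  \<open>g\<^sub>1\<close>, agent 2 gets only half of the \<open>g\<^sub>1\<close>-value there, hence at most half of it from any report
  against \<open>f\<close>. If agent 2 reports \<open>g\<^sub>2 = 7 g\<^sub>1 + f\<close>, proportionality gives at least half of the
  \<open>g\<^sub>2\<close>-value, hence at least half of the \<open>f\<close>-value, and leaves agent 1 at most half of the \<open>f\<close>-value.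
  But \<open>g\<^sub>2\<close> is smaller on \<open>A\<close> than off \<open>A\<close>, so a uniform report against \<open>g\<^sub>2\<close> yields \<open>A\<close>, whose
  \<open>f\<close>-value exceeds one half.

  The sets \<open>A\<close> and \<open>C\<close> are only measurable, so the densities are built from finite unions of
  intervals \<open>S\<close> and \<open>T\<close> approximating them. Every step is a linear inequality between lengths of
  pieces within the four cells cut out by \<open>S\<close> and \<open>T\<close>, and tolerates an error of \<open>1/1000\<close>.\<close>

section \<open>Piecewise constant functions and approximation of measurable sets\<close>

lemma piecewise_constant_combine:
  assumes f: "piecewise_constant f" and g: "piecewise_constant g"
    and k: "\<And>x. x \<in> {0..1} \<Longrightarrow> k x = F (f x) (g x)"
  shows "piecewise_constant k"
proof -
  obtain I where I: "finite I" "\<forall>i\<in>I. is_interval i" "disjoint I" "\<Union>I = {0..1}"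
      "\<forall>i\<in>I. \<forall>x\<in>i. \<forall>y\<in>i. f x = f y"
    using f unfolding piecewise_constant_def by blast
  obtain J where J: "finite J" "\<forall>i\<in>J. is_interval i" "disjoint J" "\<Union>J = {0..1}"
      "\<forall>i\<in>J. \<forall>x\<in>i. \<forall>y\<in>i. g x = g y"
    using g unfolding piecewise_constant_def by blast
  define L where "L = (\<lambda>(i, j). i \<inter> j) ` (I \<times> J)"
  have "finite L" using I(1) J(1) by (simp add: L_def)
  moreover have "\<forall>l\<in>L. is_interval l" using I(2) J(2) by (auto simp: L_def is_interval_Int)
  moreover have "disjoint L"
    unfolding disjoint_def
  proof (intro ballI impI)
    fix a b assume "a \<in> L" "b \<in> L" and ne: "a \<noteq> b"
    then obtain i j i' j' where *: "i \<in> I" "j \<in> J" "i' \<in> I" "j' \<in> J" "a = i \<inter> j" "b = i' \<inter> j'"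
      by (auto simp: L_def)
    then have "i \<inter> i' = {} \<or> j \<inter> j' = {}"
      using ne I(3) J(3) by (metis disjointD)
    then show "a \<inter> b = {}" using * by blast
  qed
  moreover have "\<Union>L = {0..1}"
  proof -
    have "\<Union>L = \<Union>I \<inter> \<Union>J" by (auto simp: L_def)
    then show ?thesis using I(4) J(4) by simp
  qed
  moreover have "\<forall>l\<in>L. \<forall>x\<in>l. \<forall>y\<in>l. k x = k y"
  proof (intro ballI)
    fix l x y assume "l \<in> L" "x \<in> l" "y \<in> l"
    then obtain i j where *: "i \<in> I" "j \<in> J" "x \<in> i" "x \<in> j" "y \<in> i" "y \<in> j"
      by (auto simp: L_def)
    then have "f x = f y" "g x = g y" using I(5) J(5) by blast+
    moreover have "x \<in> {0..1}" "y \<in> {0..1}" using * I(4) by blast+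
    ultimately show "k x = k y" using k by metis
  qed
  ultimately show ?thesis unfolding piecewise_constant_def by blast
qed

lemma piecewise_constant_indicator_interval:
  fixes J :: "real set"
  assumes "is_interval J"
  shows "piecewise_constant (indicator J)"
proof -
  \<comment> \<open>For empty \<open>J\<close> the condition is vacuous, so \<open>l\<close> is the
    whole cake and \<open>r\<close> is empty.\<close>
  define l where "l = {x \<in> {0..1} - J. \<forall>y\<in>J. x < y}"
  define r where "r = {x \<in> {0..1} - J. \<not> (\<forall>y\<in>J. x < y)}"
  define I where "I = {{0..1} \<inter> J, l, r}"
  have J: "z \<in> J" if "x \<in> J" "y \<in> J" "x \<le> z" "z \<le> y" for x y z
    using assms that unfolding is_interval_1 by blast
  have "is_interval l"
    unfolding is_interval_1 l_def by fastforce
  moreover have "is_interval r"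
    unfolding is_interval_1
  proof (intro ballI allI impI)
    fix a b x assume ab: "a \<in> r" "b \<in> r" and x: "a \<le> x \<and> x \<le> b"
    from ab(1) obtain y where y: "y \<in> J" "y \<le> a" by (auto simp: r_def not_less)
    have "b \<notin> J" using ab(2) by (auto simp: r_def)
    have "x \<notin> J"
    proof
      assume "x \<in> J"
      then have "a \<in> J" using J[of y x a] y x by simp
      then show False using ab(1) by (simp add: r_def)
    qed
    moreover have "\<not> x < y" using y x by linarith
    moreover have "0 \<le> x" "x \<le> 1" using ab x by (auto simp: r_def)
    ultimately show "x \<in> r" using y(1) unfolding r_def by auto
  qed
  ultimately have "\<forall>i\<in>I. is_interval i"
    using assms by (auto simp: I_def is_interval_Int is_interval_cc)
  moreover have "disjoint I" "\<Union>I = {0..1}" "finite I"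
    by (auto simp: I_def l_def r_def disjoint_def)
  moreover have "\<forall>i\<in>I. \<forall>x\<in>i. \<forall>y\<in>i. indicator J x = (indicator J y :: real)"
    by (auto simp: I_def l_def r_def)
  ultimately show ?thesis unfolding piecewise_constant_def by blast
qed

lemma piecewise_constant_indicator_Union:
  fixes \<J> :: "real set set"
  assumes "finite \<J>" "\<And>J. J \<in> \<J> \<Longrightarrow> is_interval J"
  shows "piecewise_constant (indicator (\<Union>\<J>))"
  using assms
proof (induction \<J> rule: finite_induct)
  case empty
  show ?case
    unfolding Union_empty by (intro piecewise_constant_indicator_interval) simp
next
  case (insert J \<J>)
  have "piecewise_constant (indicator J)" "piecewise_constant (indicator (\<Union>\<J>))"
    using insert piecewise_constant_indicator_interval by auto
  then show ?case
    by (rule piecewise_constant_combine[where F = max]) (auto simp: indicator_def)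
qed

text \<open>Squeeze \<open>A\<close> between a closed \<open>K\<close> and an open \<open>U\<close>.
  Compactness covers \<open>K\<close> by finitely many balls inside \<open>U\<close>; these are
  intervals, and the errors lie in \<open>A - K\<close> and \<open>U - A\<close>.\<close>

lemma step_set_approximation:
  fixes A :: "real set"
  assumes A: "A \<in> sets lebesgue" "A \<subseteq> {0..1}" and e: "0 < e"
  obtains S where "S \<in> sets lebesgue" "S \<subseteq> {0..1}" "piecewise_constant (indicator S)"
    "measure lebesgue (A - S) + measure lebesgue (S - A) \<le> e"
proof -
  obtain U where U: "open U" "A \<subseteq> U" "U - A \<in> lmeasurable" "emeasure lebesgue (U - A) < ennreal (e/2)"
    using sets_lebesgue_outer_open[OF A(1), of "e/2"] e by auto
  obtain K where K: "closed K" "K \<subseteq> A" "A - K \<in> lmeasurable" "emeasure lebesgue (A - K) < ennreal (e/2)"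
    using sets_lebesgue_inner_closed[OF A(1), of "e/2"] e by auto
  have "bounded K" using K(2) A(2) bounded_subset[of "{0..1::real}" K] by auto
  then have "compact K" using K(1) compact_eq_bounded_closed by blast
  define \<B> where "\<B> = {ball x d |x d. ball x d \<subseteq> U}"
  have "K \<subseteq> \<Union>\<B>"
  proof
    fix x assume "x \<in> K"
    then have "x \<in> U" using K(2) U(2) by blast
    then obtain d where "0 < d" "ball x d \<subseteq> U" using U(1) open_contains_ball by blast
    then show "x \<in> \<Union>\<B>" unfolding \<B>_def by (metis (mono_tags, lifting) UnionI centre_in_ball mem_Collect_eq)
  qed
  moreover have "\<And>B. B \<in> \<B> \<Longrightarrow> open B" by (auto simp: \<B>_def)
  ultimately obtain \<C> where C: "\<C> \<subseteq> \<B>" "finite \<C>" "K \<subseteq> \<Union>\<C>"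
    using compactE[OF \<open>compact K\<close>, of \<B>] by metis
  define S where "S = \<Union>\<C> \<inter> {0..1}"
  have "open (\<Union>\<C>)" using C(1) by (auto simp: \<B>_def)
  then have S: "S \<in> sets lebesgue" by (auto simp: S_def)
  have "S \<subseteq> U" "K \<subseteq> S" using C K(2) A(2) by (auto simp: S_def \<B>_def)
  have "piecewise_constant (indicator (\<Union>\<C>))"
    using C by (intro piecewise_constant_indicator_Union) (auto simp: \<B>_def is_interval_ball_real)
  \<comment> \<open>Only values on [0,1] matter, so cutting the union down to the cake is a
    combination that ignores its second argument.\<close>
  then have "piecewise_constant (indicator S)"
    using piecewise_constant_combine[of "indicator (\<Union>\<C>)" "indicator (\<Union>\<C>)" "indicator S" "\<lambda>a b. a"]
    by (auto simp: S_def indicator_def)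
  moreover have "measure lebesgue (A - S) \<le> e/2"
  proof -
    have "measure lebesgue (A - S) \<le> measure lebesgue (A - K)"
      using \<open>K \<subseteq> S\<close> A S K(3) by (intro measure_mono_fmeasurable) auto
    also have "\<dots> \<le> e/2" using K(4) emeasure_eq_measure2[OF K(3)] by (simp add: ennreal_less_iff)
    finally show ?thesis .
  qed
  moreover have "measure lebesgue (S - A) \<le> e/2"
  proof -
    have "measure lebesgue (S - A) \<le> measure lebesgue (U - A)"
      using \<open>S \<subseteq> U\<close> A S U(3) by (intro measure_mono_fmeasurable) auto
    also have "\<dots> \<le> e/2" using U(4) emeasure_eq_measure2[OF U(3)] by (simp add: ennreal_less_iff)
    finally show ?thesis .
  qed
  ultimately show ?thesis using that[of S] S by (auto simp: S_def)
qed

section \<open>Densities constant on four cells\<close>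

definition cell_density :: "real set \<Rightarrow> real set \<Rightarrow> real \<Rightarrow> real \<Rightarrow> real \<Rightarrow> real \<Rightarrow> real \<Rightarrow> real" where
  "cell_density S T p q r s x =
     (if x \<notin> {0..1} then 0
      else if x \<in> S then (if x \<in> T then p else q) else (if x \<in> T then r else s))"

lemma cell_density_hungry:
  assumes "piecewise_constant (indicator S)" "piecewise_constant (indicator T)"
    and "0 < p" "0 < q" "0 < r" "0 < s"
  shows "cell_density S T p q r s \<in> hungry_domain"
proof -
  have "piecewise_constant (cell_density S T p q r s)"
    by (rule piecewise_constant_combine[OF assms(1,2), where
          F = "\<lambda>a b. if a = 1 then (if b = 1 then p else q) else (if b = 1 then r else s)"])
      (auto simp: cell_density_def indicator_def)
  then show ?thesis using assms by (auto simp: hungry_domain_def cell_density_def)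
qed

lemma lmeasurable_unit_interval:
  fixes X :: "real set"
  assumes "X \<in> sets lebesgue" "X \<subseteq> {0..1}"
  shows "X \<in> lmeasurable"
  using assms by (meson fmeasurableI2 lmeasurable_cbox[of 0 "1::real"] cbox_interval lmeasurable_interval(1))

text \<open>Makes every utility a linear form in four lengths, so that fairness and truthfulness
  become linear inequalities.\<close>

lemma util_cell_density:
  assumes X: "X \<in> sets lebesgue" "X \<subseteq> {0..1}" and S: "S \<in> sets lebesgue" and T: "T \<in> sets lebesgue"
  shows "util (cell_density S T p q r s) X =
    p * measure lebesgue (X \<inter> (S \<inter> T)) + q * measure lebesgue (X \<inter> (S - T)) +
    r * measure lebesgue (X \<inter> (T - S)) + s * measure lebesgue (X \<inter> (- S \<inter> - T))"
proof -
  have "X \<in> lmeasurable"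
    using X by (rule lmeasurable_unit_interval)
  then have fm: "X \<inter> Z \<in> lmeasurable" if "Z \<in> sets lebesgue" for Z
    using that by (simp add: fmeasurable_Int_fmeasurable)
  have eq: "indicator X x *\<^sub>R cell_density S T p q r s x =
      p * indicator (X \<inter> (S \<inter> T)) x + q * indicator (X \<inter> (S - T)) x +
      r * indicator (X \<inter> (T - S)) x + s * indicator (X \<inter> (- S \<inter> - T)) x" for x
    using X(2) by (auto simp: cell_density_def indicator_def)
  have cells: "S \<inter> T \<in> sets lebesgue" "S - T \<in> sets lebesgue" "T - S \<in> sets lebesgue"
    "- S \<inter> - T \<in> sets lebesgue"
    using S T by (auto simp: Compl_eq_Diff_UNIV)
  have int: "has_bochner_integral lebesgue (\<lambda>x. c * indicator (X \<inter> Z) x) (c * measure lebesgue (X \<inter> Z))"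
    if "Z \<in> sets lebesgue" for Z and c :: real
  proof -
    have "has_bochner_integral lebesgue (indicat_real (X \<inter> Z)) (measure lebesgue (X \<inter> Z))"
      using fm[OF that] by (intro has_bochner_integral_real_indicator) (auto simp: fmeasurable_def top.not_eq_extremum)
    then show ?thesis by (rule has_bochner_integral_mult_right)
  qed
  show ?thesis
    unfolding util_def set_lebesgue_integral_def eq
    by (rule has_bochner_integral_integral_eq
        [OF has_bochner_integral_add[OF has_bochner_integral_add[OF has_bochner_integral_add]]])
      (rule int, rule cells)+
qed

text \<open>\<open>S\<close> stands in for \<open>A\<close> and \<open>T\<close> for
  \<open>C\<close>. The reports in the first bound depend on neither set and those in the second
  only on \<open>S\<close>, so \<open>S\<close> and then \<open>T\<close> can be chosen without
  circularity.\<close>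

lemma no_truthful_proportional_cells:
  fixes M :: "(real \<Rightarrow> real) \<Rightarrow> (real \<Rightarrow> real) \<Rightarrow> real set \<times> real set"
    and S T :: "real set"
  defines "d \<equiv> cell_density S T"
  assumes alloc: "\<And>f g. f \<in> hungry_domain \<Longrightarrow> g \<in> hungry_domain \<Longrightarrow> allocation2 (M f g)"
    and truth: "truthful2 hungry_domain M" and fair: "proportional2 hungry_domain M"
    and S: "S \<in> sets lebesgue" "S \<subseteq> {0..1}" "piecewise_constant (indicator S)"
    and T: "T \<in> sets lebesgue" "T \<subseteq> {0..1}" "piecewise_constant (indicator T)"
    and AS: "measure lebesgue (fst (M (d 1 1 1 1) (d 1 1 1 1)) - S) +
      measure lebesgue (S - fst (M (d 1 1 1 1) (d 1 1 1 1))) \<le> 1 / 1000"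
    and CT: "measure lebesgue (fst (M (d 7 7 9 9) (d 3 3 5 5)) - T) +
      measure lebesgue (T - fst (M (d 7 7 9 9) (d 3 3 5 5))) \<le> 1 / 1000"
  shows False
proof -

  \<comment> \<open>Lengths of pieces within the cells\<close>
  define c1 where "c1 X = measure lebesgue (X \<inter> (S \<inter> T))" for X
  define c2 where "c2 X = measure lebesgue (X \<inter> (S - T))" for X
  define c3 where "c3 X = measure lebesgue (X \<inter> (T - S))" for X
  define c4 where "c4 X = measure lebesgue (X \<inter> (- S \<inter> - T))" for X
  note c_defs = c1_def c2_def c3_def c4_def
  let ?D = "hungry_domain" and ?I = "{0..1::real}"
  \<comment> \<open>Cell by cell, \<open>g2 = 7 * g1 + fa\<close> and
    \<open>fb = g1 + 4 * one\<close>.\<close>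
  define one g1 g2 fa fb where "one = d 1 1 1 1" and "g1 = d 3 3 5 5" and "g2 = d 28 24 40 36"
    and "fa = d 7 3 5 1" and "fb = d 7 7 9 9"
  note f_defs = one_def g1_def g2_def fa_def fb_def
  have dom: "one \<in> ?D" "g1 \<in> ?D" "g2 \<in> ?D" "fa \<in> ?D" "fb \<in> ?D"
    unfolding f_defs d_def by (rule cell_density_hungry[OF S(3) T(3)]; simp)+
  have I: "?I \<in> sets lebesgue" "?I \<subseteq> ?I" by auto
  have lm: "X \<inter> Z \<in> lmeasurable" if "X \<in> sets lebesgue" "X \<subseteq> ?I" "Z \<in> sets lebesgue" for X Z
    using lmeasurable_unit_interval[OF that(1,2)] that(3) by (rule fmeasurable_Int_fmeasurable)
  have add: "measure lebesgue (V \<union> W) = measure lebesgue V + measure lebesgue W"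
    if "V \<in> lmeasurable" "W \<in> lmeasurable" "V \<inter> W = {}" for V W :: "real set"
    using that by (simp add: measure_Un3)
  have ST: "S \<inter> T \<in> sets lebesgue" "S - T \<in> sets lebesgue" "T - S \<in> sets lebesgue"
    "- S \<inter> - T \<in> sets lebesgue"
    using S(1) T(1) by (auto simp: Compl_eq_Diff_UNIV)
  have nonneg: "0 \<le> c1 X" "0 \<le> c2 X" "0 \<le> c3 X" "0 \<le> c4 X" for X by (auto simp: c_defs)
  have util: "util (d p q r s) X = p * c1 X + q * c2 X + r * c3 X + s * c4 X"
    if "X \<in> sets lebesgue" "X \<subseteq> ?I" for p q r s X
    unfolding d_def c_defs using that S(1) T(1) by (rule util_cell_density)
  have pieces: "fst (M f g) \<in> sets lebesgue" "fst (M f g) \<subseteq> ?I"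
      "snd (M f g) \<in> sets lebesgue" "snd (M f g) \<subseteq> ?I" "fst (M f g) \<inter> snd (M f g) = {}"
    if "f \<in> ?D" "g \<in> ?D" for f g
    using alloc[OF that] by (auto simp: allocation2_def)
  have le: "measure lebesgue (X \<inter> K) + measure lebesgue (Y \<inter> K) \<le> measure lebesgue (?I \<inter> K)"
    if "X \<in> sets lebesgue" "X \<subseteq> ?I" "Y \<in> sets lebesgue" "Y \<subseteq> ?I" "X \<inter> Y = {}" "K \<in> sets lebesgue" for X Y K
  proof -
    have m: "X \<inter> K \<in> lmeasurable" "Y \<inter> K \<in> lmeasurable" "?I \<inter> K \<in> lmeasurable"
      using that by (auto intro: lm)
    have "measure lebesgue (X \<inter> K \<union> Y \<inter> K) \<le> measure lebesgue (?I \<inter> K)"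
      using that m by (intro measure_mono_fmeasurable) auto
    moreover have "X \<inter> K \<inter> (Y \<inter> K) = {}" using that(5) by blast
    ultimately show ?thesis using add[OF m(1,2)] by simp
  qed
  have pack: "c1 (fst (M f g)) + c1 (snd (M f g)) \<le> c1 ?I"
     "c2 (fst (M f g)) + c2 (snd (M f g)) \<le> c2 ?I"
     "c3 (fst (M f g)) + c3 (snd (M f g)) \<le> c3 ?I"
     "c4 (fst (M f g)) + c4 (snd (M f g)) \<le> c4 ?I" if "f \<in> ?D" "g \<in> ?D" for f g
    unfolding c_defs by (rule le[OF pieces[OF that]], rule ST)+
  have compl: "measure lebesgue ((?I - X) \<inter> K) = measure lebesgue (?I \<inter> K) - measure lebesgue (X \<inter> K)"
    if "X \<in> sets lebesgue" "X \<subseteq> ?I" "K \<in> sets lebesgue" for X K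
  proof -
    have m: "X \<inter> K \<in> lmeasurable" "(?I - X) \<inter> K \<in> lmeasurable"
      using lm[OF that] lm[OF sets.Diff[OF I(1) that(1)] Diff_subset that(3)] by auto
    have "X \<inter> K \<union> (?I - X) \<inter> K = ?I \<inter> K" using that(2) by blast
    moreover have "X \<inter> K \<inter> ((?I - X) \<inter> K) = {}" by blast
    ultimately show ?thesis using add[OF m] by simp
  qed
  have dS: "measure lebesgue (X - S) + measure lebesgue (S - X) =
      c3 X + c4 X + (c1 ?I - c1 X) + (c2 ?I - c2 X)" if X: "X \<in> sets lebesgue" "X \<subseteq> ?I" for X
  proof -
    have X': "?I - X \<in> sets lebesgue" "?I - X \<subseteq> ?I"
      using sets.Diff[OF I(1) X(1)] by auto
    have "X - S = X \<inter> (T - S) \<union> X \<inter> (- S \<inter> - T)" by blast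
    then have "measure lebesgue (X - S) = c3 X + c4 X"
      using add[OF lm[OF X ST(3)] lm[OF X ST(4)]] by (auto simp: c_defs)
    moreover have "S - X = (?I - X) \<inter> (S \<inter> T) \<union> (?I - X) \<inter> (S - T)" using S(2) by blast
    then have "measure lebesgue (S - X) = (c1 ?I - c1 X) + (c2 ?I - c2 X)"
      unfolding c_defs compl[OF X ST(1), symmetric] compl[OF X ST(2), symmetric]
      by (simp only:) (rule add[OF lm[OF X' ST(1)] lm[OF X' ST(2)]], blast)
    ultimately show ?thesis by simp
  qed
  have dT: "measure lebesgue (X - T) + measure lebesgue (T - X) =
      c2 X + c4 X + (c1 ?I - c1 X) + (c3 ?I - c3 X)" if X: "X \<in> sets lebesgue" "X \<subseteq> ?I" for X
  proof -
    have X': "?I - X \<in> sets lebesgue" "?I - X \<subseteq> ?I"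
      using sets.Diff[OF I(1) X(1)] by auto
    have "X - T = X \<inter> (S - T) \<union> X \<inter> (- S \<inter> - T)" by blast
    then have "measure lebesgue (X - T) = c2 X + c4 X"
      using add[OF lm[OF X ST(2)] lm[OF X ST(4)]] by (auto simp: c_defs)
    moreover have "T - X = (?I - X) \<inter> (S \<inter> T) \<union> (?I - X) \<inter> (T - S)" using T(2) by blast
    then have "measure lebesgue (T - X) = (c1 ?I - c1 X) + (c3 ?I - c3 X)"
      unfolding c_defs compl[OF X ST(1), symmetric] compl[OF X ST(3), symmetric]
      by (simp only:) (rule add[OF lm[OF X' ST(1)] lm[OF X' ST(3)]], blast)
    ultimately show ?thesis by simp
  qed
  have total: "c1 ?I + c2 ?I + c3 ?I + c4 ?I = 1"
  proof -
    have "measure lebesgue S = c1 ?I + c2 ?I"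
      using dS[of "{}"] by (simp add: c_defs)
    moreover have "measure lebesgue (?I - S) = c3 ?I + c4 ?I"
      using dS[OF I] S(2) by (simp add: Diff_eq_empty_iff[THEN iffD2])
    moreover have "measure lebesgue (?I - S) = 1 - measure lebesgue S"
      using compl[OF S(1,2), of UNIV] by simp
    ultimately show ?thesis by simp
  qed
  have ir: "util f ?I / 2 \<le> util f (fst (M f g))" "util g ?I / 2 \<le> util g (snd (M f g))"
    if "f \<in> ?D" "g \<in> ?D" for f g
    using fair that by (auto simp: proportional2_def)
  have ic: "util f (fst (M f' g)) \<le> util f (fst (M f g))" "util g (snd (M f g')) \<le> util g (snd (M f g))"
    if "f \<in> ?D" "g \<in> ?D" "f' \<in> ?D" "g' \<in> ?D" for f g f' g'
    using truth that by (auto simp: truthful2_def)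

  \<comment> \<open>Linear inequalities from six profiles\<close>
  define A B P Q C C' X Y X' Y' Z Z'
    where "A = fst (M one one)" and "B = snd (M one one)"
      and "P = fst (M one g1)" and "Q = snd (M one g1)"
      and "C = fst (M fb g1)" and "C' = snd (M fb g1)"
      and "X = fst (M fa g1)" and "Y = snd (M fa g1)"
      and "X' = fst (M fa g2)" and "Y' = snd (M fa g2)"
      and "Z = fst (M one g2)" and "Z' = snd (M one g2)"
  note M_defs = A_def B_def P_def Q_def C_def C'_def X_def Y_def X'_def Y'_def Z_def Z'_def
  have u_pieces: "util (d p q r s) (fst (M f g)) = p * c1 (fst (M f g)) + q * c2 (fst (M f g)) +
        r * c3 (fst (M f g)) + s * c4 (fst (M f g))"
      "util (d p q r s) (snd (M f g)) = p * c1 (snd (M f g)) + q * c2 (snd (M f g)) +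
        r * c3 (snd (M f g)) + s * c4 (snd (M f g))" if "f \<in> ?D" "g \<in> ?D" for p q r s f g
    using util pieces[OF that] by blast+
  note u = util[OF I] u_pieces[OF dom(1) dom(1), folded M_defs] u_pieces[OF dom(1) dom(2), folded M_defs]
    u_pieces[OF dom(5) dom(2), folded M_defs] u_pieces[OF dom(4) dom(2), folded M_defs]
    u_pieces[OF dom(4) dom(3), folded M_defs] u_pieces[OF dom(1) dom(3), folded M_defs]
  have A1: "c1 A + c2 A + c3 A + c4 A \<ge> 1/2" and B1: "c1 B + c2 B + c3 B + c4 B \<ge> 1/2"
    using ir[OF dom(1) dom(1), folded M_defs] total by (simp_all add: u one_def)
  have AS': "c3 A + c4 A + (c1 ?I - c1 A) + (c2 ?I - c2 A) \<le> 1/1000"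
    using AS dS[of A] pieces[OF dom(1) dom(1)] by (simp add: A_def one_def)
  have CT': "c2 C + c4 C + (c1 ?I - c1 C) + (c3 ?I - c3 C) \<le> 1/1000"
    using CT dT[of C] pieces[OF dom(5) dom(2)] by (simp add: C_def fb_def g1_def)
  have P1: "c1 P + c2 P + c3 P + c4 P \<ge> 1/2"
    using ir(1)[OF dom(1) dom(2), folded M_defs] total by (simp add: u one_def)
  have Q1: "3 * c1 B + 3 * c2 B + 5 * c3 B + 5 * c4 B \<le> 3 * c1 Q + 3 * c2 Q + 5 * c3 Q + 5 * c4 Q"
    using ic(2)[OF dom(1) dom(2) dom(1) dom(1), folded M_defs] by (simp add: u g1_def)
  have C1: "(7 * c1 ?I + 7 * c2 ?I + 9 * c3 ?I + 9 * c4 ?I) / 2 \<le> 7 * c1 C + 7 * c2 C + 9 * c3 C + 9 * c4 C"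
    and C2: "(3 * c1 ?I + 3 * c2 ?I + 5 * c3 ?I + 5 * c4 ?I) / 2 \<le> 3 * c1 C' + 3 * c2 C' + 5 * c3 C' + 5 * c4 C'"
    using ir[OF dom(5) dom(2), folded M_defs] by (simp_all add: u fb_def g1_def)
  have C3: "c1 C + c2 C + c3 C + c4 C \<le> c1 P + c2 P + c3 P + c4 P"
    using ic(1)[OF dom(1) dom(2) dom(5) dom(2), folded M_defs] by (simp add: u one_def)
  have X1: "7 * c1 C + 3 * c2 C + 5 * c3 C + c4 C \<le> 7 * c1 X + 3 * c2 X + 5 * c3 X + c4 X"
    using ic(1)[OF dom(4) dom(2) dom(5) dom(2), folded M_defs] by (simp add: u fa_def)
  have Y1: "3 * c1 Y' + 3 * c2 Y' + 5 * c3 Y' + 5 * c4 Y' \<le> 3 * c1 Y + 3 * c2 Y + 5 * c3 Y + 5 * c4 Y"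
    using ic(2)[OF dom(4) dom(2) dom(4) dom(3), folded M_defs] by (simp add: u g1_def)
  have Y2: "(28 * c1 ?I + 24 * c2 ?I + 40 * c3 ?I + 36 * c4 ?I) / 2
      \<le> 28 * c1 Y' + 24 * c2 Y' + 40 * c3 Y' + 36 * c4 Y'"
    using ir(2)[OF dom(4) dom(3), folded M_defs] by (simp add: u g2_def)
  have X2: "7 * c1 Z + 3 * c2 Z + 5 * c3 Z + c4 Z \<le> 7 * c1 X' + 3 * c2 X' + 5 * c3 X' + c4 X'"
    using ic(1)[OF dom(4) dom(3) dom(1) dom(3), folded M_defs] by (simp add: u fa_def)
  have Z1: "c1 Z + c2 Z + c3 Z + c4 Z \<ge> 1/2"
    using ir(1)[OF dom(1) dom(3), folded M_defs] total by (simp add: u one_def)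
  have Z2: "28 * c1 B + 24 * c2 B + 40 * c3 B + 36 * c4 B \<le> 28 * c1 Z' + 24 * c2 Z' + 40 * c3 Z' + 36 * c4 Z'"
    using ic(2)[OF dom(1) dom(3) dom(1) dom(1), folded M_defs] by (simp add: u g2_def)
  note pack' = pack[OF dom(1) dom(1), folded M_defs] pack[OF dom(1) dom(2), folded M_defs]
     pack[OF dom(5) dom(2), folded M_defs] pack[OF dom(4) dom(2), folded M_defs]
     pack[OF dom(4) dom(3), folded M_defs] pack[OF dom(1) dom(3), folded M_defs]
  note nn = nonneg[of A] nonneg[of B] nonneg[of P] nonneg[of Q] nonneg[of C] nonneg[of C']
    nonneg[of X] nonneg[of Y] nonneg[of X'] nonneg[of Y'] nonneg[of Z] nonneg[of Z']
  \<comment> \<open>Both pieces have length at least 1/2, so every packing bound is tight and no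
    length is wasted.\<close>
  have B_eq: "c1 B = c1 ?I - c1 A" "c2 B = c2 ?I - c2 A" "c3 B = c3 ?I - c3 A" "c4 B = c4 ?I - c4 A"
    using total A1 B1 pack'(1-4) by argo+
  have A_sum: "c1 A + c2 A + c3 A + c4 A = 1/2"
    using total A1 B1 pack'(1-4) by argo
  have "3 * (c1 P + c2 P) + 5 * (c3 P + c4 P) \<le> 3 * (c1 A + c2 A) + 5 * (c3 A + c4 A)"
    using Q1 pack'(5-8) unfolding B_eq by argo
  moreover have "c3 A + c4 A \<le> 1/1000"
    using AS' pack'(1-4) nn(5-8) by argo
  ultimately have P_le: "c1 P + c2 P + c3 P + c4 P \<le> 1/2 + 1/1000"
    using A_sum nn(9-12) by argo
  \<comment> \<open>Subtract 4 times the length of \<open>C\<close> from its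
    \<open>fb\<close>-value.\<close>
  have C_g1: "3 * (c1 C + c2 C) + 5 * (c3 C + c4 C) \<ge> (3 * (c1 ?I + c2 ?I) + 5 * (c3 ?I + c4 ?I)) / 2 - 4/1000"
    using C1 C3 P_le total by argo
  \<comment> \<open>With \<open>a\<close>, \<open>b\<close> the excess of \<open>C\<close> over half
    of \<open>S\<close> and half of its complement, \<open>7a + 9b \<ge> 0\<close> and
    \<open>3a + 5b \<le> 0\<close>; five times the first minus nine times the second gives
    \<open>8a \<ge> 0\<close>.\<close>
  have C_S: "c1 C + c2 C \<ge> (c1 ?I + c2 ?I) / 2"
    using C1 C2 pack'(9-12) by argo
  have C_small: "c2 C + c4 C \<le> 1/1000" "c1 C + c3 C \<ge> c1 ?I + c3 ?I - 1/1000"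
    using CT' pack'(9-12) nn(17-24) by argo+
  have "7 * c1 C + 5 * c3 C \<ge> 7 * c1 ?I + 5 * c3 ?I - 7/1000"
    using C_small pack'(9-12) nn(17-24) by argo
  \<comment> \<open>The \<open>fa\<close>-value of \<open>X\<close> plus the \<open>g1\<close>-value
    of \<open>Y\<close> is at most the total of the cellwise maximum \<open>7, 3, 5, 5\<close>, and
    \<open>X\<close> is worth at least as much as \<open>C\<close>.\<close>
  then have "3 * c1 Y + 3 * c2 Y + 5 * c3 Y + 5 * c4 Y \<le> 3 * c2 ?I + 5 * c4 ?I + 7/1000"
    using X1 pack'(13-16) nn(17-32) by argo
  moreover have "3 * c2 ?I + 5 * c4 ?I \<le> (3 * (c1 ?I + c2 ?I) + 5 * (c3 ?I + c4 ?I)) / 2 + 9/1000"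
    using C_g1 C_small pack'(9-12) nn(17-24) by argo
  \<comment> \<open>Subtracting 7 times the \<open>g1\<close>-bound from the \<open>g2\<close>-bound
    leaves \<open>fa\<close>; the error is 7 times (7 + 9)/1000.\<close>
  ultimately have "7 * c1 Y' + 3 * c2 Y' + 5 * c3 Y' + c4 Y' \<ge>
      (7 * c1 ?I + 3 * c2 ?I + 5 * c3 ?I + c4 ?I) / 2 - 112/1000"
    using Y1 Y2 by argo
  then have X'_le: "7 * c1 X' + 3 * c2 X' + 5 * c3 X' + c4 X' \<le>
      (7 * c1 ?I + 3 * c2 ?I + 5 * c3 ?I + c4 ?I) / 2 + 112/1000"
    using pack'(17-20) by argo
  have "28 * c1 Z + 24 * c2 Z + 40 * c3 Z + 36 * c4 Z \<le> 28 * c1 A + 24 * c2 A + 40 * c3 A + 36 * c4 A"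
    using Z2 pack'(21-24) unfolding B_eq by argo
  \<comment> \<open>\<open>Z\<close> is at least as long as \<open>A\<close>, so 32 times the length
    may be subtracted. As 32 separates the values of \<open>g2\<close> on \<open>S\<close> from
    those off \<open>S\<close>, this forces \<open>Z\<close> to nearly fill
    \<open>S\<close>.\<close>
  then have "- 4 * c1 Z - 8 * c2 Z + 8 * c3 Z + 4 * c4 Z \<le> - 4 * c1 A - 8 * c2 A + 8 * c3 A + 4 * c4 A"
    using Z1 A_sum by argo
  also have "\<dots> \<le> - 4 * c1 ?I - 8 * c2 ?I + 8/1000"
    using AS' pack'(1-4) nn(1-8) by argo
  finally have "7 * c1 Z + 3 * c2 Z \<ge> 7 * c1 ?I + 3 * c2 ?I - 14/1000"
    using pack'(21-24) nn(41-48) by argo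
  then have "7 * c1 ?I + 3 * c2 ?I - 5 * c3 ?I - c4 ?I \<le> 252/1000"
    using X2 X'_le nn(41-44) by argo
  moreover have "c1 ?I + c2 ?I \<ge> 1/2 - 1/1000"
    using AS' A_sum pack'(1-4) nn(1-8) by argo
  moreover have "c1 ?I \<ge> (c1 ?I + c2 ?I) / 2 - 1/1000"
    using C_S C_small nn(21-24) pack'(9-12) nn(17-20) by argo
  moreover have "c1 ?I + c3 ?I \<le> 1/2 + 2/1000"
    using C3 P_le C_small nn(17-20) by argo
  \<comment> \<open>Up to small errors the last three bounds make \<open>7, 3, -5, -1\<close> weigh
    the cells at \<open>1 + 4 * (c1 ?I - c3 ?I) \<ge> 1\<close>, far above 252/1000.\<close>
  ultimately show False using total by argo
qed

section \<open>Choice of the two step sets\<close>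

theorem theorem1:
  shows "\<not> (\<exists>M. (\<forall>f1\<in>hungry_domain. \<forall>f2\<in>hungry_domain. allocation2 (M f1 f2)) \<and>
               truthful2 hungry_domain M \<and> proportional2 hungry_domain M)"
proof
  assume "\<exists>M. (\<forall>f1\<in>hungry_domain. \<forall>f2\<in>hungry_domain. allocation2 (M f1 f2)) \<and>
               truthful2 hungry_domain M \<and> proportional2 hungry_domain M"
  then obtain M where alloc: "\<And>f g. f \<in> hungry_domain \<Longrightarrow> g \<in> hungry_domain \<Longrightarrow> allocation2 (M f g)"
    and M: "truthful2 hungry_domain M" "proportional2 hungry_domain M" by blast
  have piece: "fst (M f g) \<in> sets lebesgue" "fst (M f g) \<subseteq> {0..1}"
    if "f \<in> hungry_domain" "g \<in> hungry_domain" for f g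
    using alloc[OF that] by (auto simp: allocation2_def)
  have empty: "piecewise_constant (indicator {})"
    by (intro piecewise_constant_indicator_interval) simp
  \<comment> \<open>The mechanism sees only functions, so reports formed before \<open>S\<close> or
    \<open>T\<close> is chosen must equal those written with both sets.\<close>
  have const: "cell_density U V a a a a = cell_density {} {} a a a a" for U V a
    by (auto simp: cell_density_def fun_eq_iff)
  have row: "cell_density U V a a b b = cell_density U {} a a b b" for U V a b
    by (auto simp: cell_density_def fun_eq_iff)
  let ?one = "cell_density {} {} 1 1 1 1"
  have "?one \<in> hungry_domain" by (rule cell_density_hungry[OF empty empty]) auto
  then obtain S where S: "S \<in> sets lebesgue" "S \<subseteq> {0..1}" "piecewise_constant (indicator S)"
    "measure lebesgue (fst (M ?one ?one) - S) + measure lebesgue (S - fst (M ?one ?one)) \<le> 1 / 1000"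
    using step_set_approximation[OF piece, of ?one ?one "1 / 1000"] by auto
  let ?g = "cell_density S {} 3 3 5 5" and ?f = "cell_density S {} 7 7 9 9"
  have "?g \<in> hungry_domain" "?f \<in> hungry_domain"
    by (rule cell_density_hungry[OF S(3) empty]; simp)+
  then obtain T where T: "T \<in> sets lebesgue" "T \<subseteq> {0..1}" "piecewise_constant (indicator T)"
    "measure lebesgue (fst (M ?f ?g) - T) + measure lebesgue (T - fst (M ?f ?g)) \<le> 1 / 1000"
    using step_set_approximation[OF piece, of ?f ?g "1 / 1000"] by auto
  show False
    using no_truthful_proportional_cells[OF alloc M S(1-3) T(1-3)] S(4) T(4)
    by (simp add: const[of S T] row[of S T])
qed

end
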